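(* Let $X$ be a complex Banach space. The mapping $\Phi:\mathcal{H}L_0(B_X)\to \mathcal{H}^\infty_s(B_X,X^* )$ given by $\Phi(f)=df$ is an isometric isomorphism.
   Context: $B_X$ is the open unit ball of $X$ and $X^*$ is the topological dual of $X$. For a complex Banach space $Y$, a map $f:B_X\to Y$ is holomorphic if it is (complex) Fréchet differentiable at every point of $B_X$; its differential at $x$ is the continuous complex-linear map $df(x):X\to Y$. $\mathcal{H}^\infty(B_X,Y)$ is the Banach space of bounded holomorphic maps $f:B_X\to Y$ with norm $\|f\|=\sup_{x\in B_X}\|f(x)\|$. $\mathcal{H}L_0(B_X)$ is the Banach space of all bounded holomorphic functions $f:B_X\to\mathbb{C}$ which are Lipschitz and satisfy $f(0)=0$, with norm $L(f)=\sup\{|f(x)-f(y)|/\|x-y\| : x\ne y\in B_X\}$. For a map $g:B_X\to X^*$ and $x\in X$, $x\circ g:B_X\to\mathbb{C}$ denotes the function $u\mapsto g(u)(x)$. In particular, for holomorphic $g$ and $x,y\in X$, $y\circ d(x\circ g)$ is the function $u\mapsto d(x\circ g)(u)(y)$. Define $$\mathcal{H}^\infty_s(B_X,X^* )=\{g\in \mathcal{H}^\infty(B_X,X^* ) : y\circ d(x\circ g)=x\circ d(y\circ g)\ \text{ for all } x,y\in X\},$$ endowed with the norm inherited from $\mathcal{H}^\infty(B_X,X^* )$. An isometric isomorphism is a surjective linear isometry. *)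

theory Defs
  imports "HOL-Analysis.Analysis"
begin

subsection \<open>Complex normed spaces and complex Banach spaces\<close>

class scaleC =
  fixes scaleC :: "complex \<Rightarrow> 'a \<Rightarrow> 'a"  (infixr "*\<^sub>C" 75)

class complex_normed_vector = real_normed_vector + scaleC +
  assumes scaleC_add_right: "a *\<^sub>C (x + y) = a *\<^sub>C x + a *\<^sub>C y"
    and scaleC_add_left: "(a + b) *\<^sub>C x = a *\<^sub>C x + b *\<^sub>C x"
    and scaleC_scaleC: "a *\<^sub>C (b *\<^sub>C x) = (a * b) *\<^sub>C x"
    and scaleC_one: "1 *\<^sub>C x = x"
    and scaleR_scaleC: "r *\<^sub>R x = complex_of_real r *\<^sub>C x"
    and norm_scaleC: "norm (a *\<^sub>C x) = cmod a * norm x"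

class complex_banach = complex_normed_vector + banach

instantiation complex :: complex_banach
begin

definition scaleC_complex :: "complex \<Rightarrow> complex \<Rightarrow> complex"
  where "scaleC_complex a x = a * x"

instance
  by standard (auto simp: scaleC_complex_def algebra_simps norm_mult scaleR_conv_of_real)

end

lemma scaleC_zero_right: "a *\<^sub>C (0::'a::complex_normed_vector) = 0"
  using norm_scaleC[of a "0::'a"] by simp

definition bounded_clinear ::
    "('a::complex_normed_vector \<Rightarrow> 'b::complex_normed_vector) \<Rightarrow> bool"
  where "bounded_clinear f \<longleftrightarrow> bounded_linear f \<and> (\<forall>c x. f (c *\<^sub>C x) = c *\<^sub>C f x)"

lemma bounded_linear_scaleC_right:
  "bounded_linear (\<lambda>x::'a::complex_normed_vector. c *\<^sub>C x)"
  by (rule bounded_linear_intro[where K="cmod c"])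
    (simp_all add: scaleC_add_right scaleR_scaleC scaleC_scaleC norm_scaleC mult.commute)

subsection \<open>The topological dual\<close>

typedef (overloaded) 'a cdual = "{f :: 'a::complex_normed_vector \<Rightarrow> complex. bounded_clinear f}"
  morphisms cdual_apply Cdual
  by (rule exI[of _ "\<lambda>_. 0"]) (simp add: bounded_clinear_def scaleC_zero_right)

lemma bounded_clinear_cdual_apply: "bounded_clinear (cdual_apply g)"
  using cdual_apply[of g] by simp

lemma bounded_linear_cdual_apply: "bounded_linear (cdual_apply g)"
  using bounded_clinear_cdual_apply[of g] by (simp add: bounded_clinear_def)

setup_lifting type_definition_cdual

instantiation cdual :: (complex_normed_vector) complex_normed_vector
begin

lift_definition norm_cdual :: "'a cdual \<Rightarrow> real" is onorm .

lift_definition zero_cdual :: "'a cdual" is "\<lambda>_. 0"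
  by (simp add: bounded_clinear_def scaleC_zero_right)

lift_definition plus_cdual :: "'a cdual \<Rightarrow> 'a cdual \<Rightarrow> 'a cdual" is "\<lambda>f g x. f x + g x"
  by (auto simp: bounded_clinear_def scaleC_add_right intro: bounded_linear_add)

lift_definition uminus_cdual :: "'a cdual \<Rightarrow> 'a cdual" is "\<lambda>f x. - f x"
  by (auto simp: bounded_clinear_def scaleC_complex_def intro: bounded_linear_minus)

lift_definition minus_cdual :: "'a cdual \<Rightarrow> 'a cdual \<Rightarrow> 'a cdual" is "\<lambda>f g x. f x - g x"
  by (auto simp: bounded_clinear_def scaleC_complex_def right_diff_distrib intro: bounded_linear_sub)

lift_definition scaleC_cdual :: "complex \<Rightarrow> 'a cdual \<Rightarrow> 'a cdual" is "\<lambda>c f x. c *\<^sub>C f x"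
  by (auto simp: bounded_clinear_def scaleC_scaleC mult.commute
      intro: bounded_linear_compose[OF bounded_linear_scaleC_right])

definition scaleR_cdual :: "real \<Rightarrow> 'a cdual \<Rightarrow> 'a cdual"
  where "scaleR_cdual r f = complex_of_real r *\<^sub>C f"

definition dist_cdual :: "'a cdual \<Rightarrow> 'a cdual \<Rightarrow> real"
  where "dist_cdual f g = norm (f - g)"

definition sgn_cdual :: "'a cdual \<Rightarrow> 'a cdual"
  where "sgn_cdual f = inverse (norm f) *\<^sub>R f"

definition [code del]:
  "(uniformity :: ('a cdual \<times> 'a cdual) filter) = (INF e\<in>{0 <..}. principal {(x, y). dist x y < e})"

definition open_cdual :: "'a cdual set \<Rightarrow> bool"
  where [code del]: "open_cdual S = (\<forall>x\<in>S. \<forall>\<^sub>F (x', y) in uniformity. x' = x \<longrightarrow> y \<in> S)"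

instance
proof
  fix f g h :: "'a cdual" and a b :: complex and r s :: real
  have nC: "norm (a *\<^sub>C f) = cmod a * norm f" for a and f :: "'a cdual"
  proof (transfer fixing: a)
    fix f :: "'a \<Rightarrow> complex" assume "bounded_clinear f"
    then have f: "bounded_linear f" by (simp add: bounded_clinear_def)
    have 1: "onorm (\<lambda>x. c *\<^sub>C F x) \<le> cmod c * onorm F"
      if F: "bounded_linear F" for c and F :: "'a \<Rightarrow> complex"
    proof (rule onorm_bound)
      show "0 \<le> cmod c * onorm F" by (simp add: onorm_pos_le[OF F])
      fix x show "norm (c *\<^sub>C F x) \<le> cmod c * onorm F * norm x"
        using mult_left_mono[OF onorm[OF F, of x], of "cmod c"] by (simp add: norm_scaleC mult.assoc)
    qed
    show "onorm (\<lambda>x. a *\<^sub>C f x) = cmod a * onorm f"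
    proof (cases "a = 0")
      case True
      then show ?thesis by (simp add: scaleC_complex_def onorm_zero)
    next
      case False
      have bl: "bounded_linear (\<lambda>x. a *\<^sub>C f x)"
        by (rule bounded_linear_compose[OF bounded_linear_scaleC_right f])
      have "onorm f \<le> cmod (inverse a) * onorm (\<lambda>x. a *\<^sub>C f x)"
        using 1[OF bl, of "inverse a"] False by (simp add: scaleC_scaleC scaleC_one)
      then have "cmod a * onorm f \<le> onorm (\<lambda>x. a *\<^sub>C f x)"
        using False by (simp only: norm_inverse) (simp add: inverse_eq_divide pos_le_divide_eq mult.commute)
      with 1[OF f, of a] show ?thesis by simp
    qed
  qed
  show "f + g + h = f + (g + h)" "f + g = g + f" "0 + f = f" "- f + f = 0" "f - g = f + - g"
    by (transfer; force)+
  show aR: "a *\<^sub>C (f + g) = a *\<^sub>C f + a *\<^sub>C g"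
    and aL: "(a + b) *\<^sub>C f = a *\<^sub>C f + b *\<^sub>C f"
    and ss: "a *\<^sub>C (b *\<^sub>C f) = (a * b) *\<^sub>C f" and s1: "1 *\<^sub>C f = f"
    for a b and f g :: "'a cdual"
    by (transfer; force simp: scaleC_add_right scaleC_add_left scaleC_scaleC scaleC_one)+
  show "r *\<^sub>R f = complex_of_real r *\<^sub>C f" by (simp add: scaleR_cdual_def)
  show "r *\<^sub>R (f + g) = r *\<^sub>R f + r *\<^sub>R g" "(r + s) *\<^sub>R f = r *\<^sub>R f + s *\<^sub>R f"
    "r *\<^sub>R (s *\<^sub>R f) = (r * s) *\<^sub>R f" "1 *\<^sub>R f = f"
    by (simp_all add: scaleR_cdual_def aR aL ss s1)
  show "dist f g = norm (f - g)" by (simp add: dist_cdual_def)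
  show "sgn f = inverse (norm f) *\<^sub>R f" by (simp add: sgn_cdual_def)
  show "uniformity = (INF e\<in>{0 <..}. principal {(x, y). dist x (y :: 'a cdual) < e})"
    by (simp add: uniformity_cdual_def)
  show "open U = (\<forall>x\<in>U. \<forall>\<^sub>F (x', y) in uniformity. x' = x \<longrightarrow> y \<in> U)" for U :: "'a cdual set"
    by (simp add: open_cdual_def)
  show "(norm f = 0) = (f = 0)"
    by transfer (auto simp: bounded_clinear_def onorm_eq_0)
  show "norm (f + g) \<le> norm f + norm g"
    by transfer (auto simp: bounded_clinear_def intro: onorm_triangle)
  show "norm (a *\<^sub>C f) = cmod a * norm f" by (rule nC)
  show "norm (r *\<^sub>R f) = \<bar>r\<bar> * norm f" by (simp add: scaleR_cdual_def nC)
qed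

end

instance cdual :: (complex_normed_vector) complex_banach
proof
  fix X :: "nat \<Rightarrow> 'a cdual" assume X: "Cauchy X"
  define Y where "Y n = Blinfun (cdual_apply (X n))" for n
  have Y: "blinfun_apply (Y n) = cdual_apply (X n)" for n
    by (simp add: Y_def bounded_linear_Blinfun_apply bounded_linear_cdual_apply)
  have "dist (Y m) (Y n) = dist (X m) (X n)" for m n
    by (simp add: dist_norm norm_blinfun.rep_eq norm_cdual.rep_eq minus_blinfun.rep_eq
        minus_cdual.rep_eq Y)
  with X have "Cauchy Y" by (simp add: Cauchy_def)
  then obtain L where L: "Y \<longlonglongrightarrow> L"
    using Cauchy_convergent_iff[of Y] unfolding convergent_def by blast
  have lim: "(\<lambda>n. cdual_apply (X n) x) \<longlonglongrightarrow> blinfun_apply L x" for x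
    using blinfun.tendsto[OF L tendsto_const, of x] by (simp add: Y)
  have "blinfun_apply L (c *\<^sub>C x) = c *\<^sub>C blinfun_apply L x" for c x
  proof (rule LIMSEQ_unique[OF lim])
    have "cdual_apply (X n) (c *\<^sub>C x) = c * cdual_apply (X n) x" for n
      using bounded_clinear_cdual_apply[of "X n"]
      by (simp add: bounded_clinear_def scaleC_complex_def)
    then show "(\<lambda>n. cdual_apply (X n) (c *\<^sub>C x)) \<longlonglongrightarrow> c *\<^sub>C blinfun_apply L x"
      by (simp add: scaleC_complex_def tendsto_mult_left[OF lim])
  qed
  then have cl: "bounded_clinear (blinfun_apply L)"
    by (simp add: bounded_clinear_def blinfun.bounded_linear_right)
  define M where "M = Cdual (blinfun_apply L)"
  have M: "cdual_apply M = blinfun_apply L"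
    using cl by (simp add: M_def Cdual_inverse)
  have "dist (X n) M = dist (Y n) L" for n
    by (simp add: dist_norm norm_blinfun.rep_eq norm_cdual.rep_eq minus_blinfun.rep_eq
        minus_cdual.rep_eq Y M)
  with L have "X \<longlonglongrightarrow> M" by (simp add: tendsto_iff)
  then show "convergent X" by (auto simp: convergent_def)
qed

subsection \<open>Bounded holomorphic maps on the open unit ball\<close>

definition holomorphic_on_ball ::
    "('a::complex_banach \<Rightarrow> 'b::complex_banach) \<Rightarrow> bool"
  where "holomorphic_on_ball f \<longleftrightarrow>
    (\<forall>u\<in>ball 0 1. \<exists>D. bounded_clinear D \<and> (f has_derivative D) (at u))"

text \<open>
  A map defined on the open unit ball only is represented by its extension by \<open>0\<close> to
  the whole space. This makes the representation unique, and makes the spaces of maps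
  below closed under the pointwise operations.
\<close>

definition supported_on_ball :: "('a::real_normed_vector \<Rightarrow> 'b::zero) \<Rightarrow> bool"
  where "supported_on_ball f \<longleftrightarrow> (\<forall>u. u \<notin> ball 0 1 \<longrightarrow> f u = 0)"

definition Hinf :: "('a::complex_banach \<Rightarrow> 'b::complex_banach) set"
  where "Hinf = {f. supported_on_ball f \<and> holomorphic_on_ball f \<and> bounded (f ` ball 0 1)}"

definition Hinf_norm :: "('a::complex_banach \<Rightarrow> 'b::complex_banach) \<Rightarrow> real"
  where "Hinf_norm f = (SUP u\<in>ball 0 1. norm (f u))"

definition HL0 :: "('a::complex_banach \<Rightarrow> complex) set"
  where "HL0 = {f \<in> Hinf. (\<exists>K. K-lipschitz_on (ball 0 1) f) \<and> f 0 = 0}"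

text \<open>
  Inserting \<open>0\<close> changes the supremum only for the zero space, where the set of
  difference quotients is empty and the real supremum would be unspecified.
\<close>

definition lip_norm :: "('a::complex_banach \<Rightarrow> complex) \<Rightarrow> real"
  where "lip_norm f = Sup (insert 0
    {cmod (f x - f y) / norm (x - y) | x y. x \<in> ball 0 1 \<and> y \<in> ball 0 1 \<and> x \<noteq> y})"

definition Hinf_s :: "('a::complex_banach \<Rightarrow> 'a cdual) set"
  where "Hinf_s = {g \<in> Hinf. \<forall>x y. \<forall>u\<in>ball 0 1.
    frechet_derivative (\<lambda>v. cdual_apply (g v) x) (at u) y =
    frechet_derivative (\<lambda>v. cdual_apply (g v) y) (at u) x}"

definition differential :: "('a::complex_banach \<Rightarrow> complex) \<Rightarrow> 'a \<Rightarrow> 'a cdual"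
  where "differential f = (\<lambda>u. if u \<in> ball 0 1 then Cdual (frechet_derivative f (at u)) else 0)"

definition isometric_isomorphism ::
    "('a \<Rightarrow> 'b::complex_normed_vector) set \<Rightarrow> (('a \<Rightarrow> 'b) \<Rightarrow> real) \<Rightarrow>
     ('c \<Rightarrow> 'd::complex_normed_vector) set \<Rightarrow> (('c \<Rightarrow> 'd) \<Rightarrow> real) \<Rightarrow>
     (('a \<Rightarrow> 'b) \<Rightarrow> 'c \<Rightarrow> 'd) \<Rightarrow> bool"
  where "isometric_isomorphism V N W M T \<longleftrightarrow>
    (\<forall>f\<in>V. \<forall>g\<in>V. T (\<lambda>x. f x + g x) = (\<lambda>u. T f u + T g u)) \<and>
    (\<forall>c. \<forall>f\<in>V. T (\<lambda>x. c *\<^sub>C f x) = (\<lambda>u. c *\<^sub>C T f u)) \<and>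
    (\<forall>f\<in>V. M (T f) = N f) \<and>
    T ` V = W"

end

theory Submission
  imports Defs "HOL-Complex_Analysis.Cauchy_Integral_Formula"
begin

text \<open>
  For a holomorphic \<open>f\<close> the supremum of \<open>\<parallel>df(u)\<parallel>\<close> over the ball is the best Lipschitz constant of
  \<open>f\<close>: one inequality is the mean value inequality on the convex ball
  (\<open>differential_bound_imp_lipschitz_bound\<close>), the other holds because \<open>df(u)(h)\<close> is a limit of
  difference quotients of \<open>f\<close> (\<open>lipschitz_bound_imp_differential_bound\<close>). So the differential is
  isometric, and what remains is to identify its range.

  That \<open>df\<close> lies in the range claimed means that \<open>df\<close>, as a map into the dual with its norm, is
  again Frechet differentiable and that its derivative is a symmetric bilinear form
  (\<open>differential_has_symmetric_derivative\<close>). Everything is reduced to one complex variable by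
  restricting to complex lines. On a line, Cauchy's inequality bounds the first derivative and the
  quadratic Taylor remainder in terms of the supremum of the function alone, hence uniformly in the
  line. The remainder bound shows that the difference quotients of \<open>f\<close> in a direction \<open>h\<close> converge to
  \<open>v \<mapsto> df(v)(h)\<close> uniformly on discs of a line in a direction \<open>k\<close>. Derivatives pass to such limits, so the
  second directional derivatives \<open>A(k,h)\<close> exist, and the derivative of the limit being the limit of
  the derivatives says that \<open>A(k,h) = A(h,k)\<close>. Linearity of \<open>A\<close> in \<open>h\<close> is obvious; linearity in
  \<open>k\<close> then comes from the symmetry. The remainder bound, applied this time to \<open>v \<mapsto> df(v)(h)\<close>, is
  uniform in \<open>\<parallel>h\<parallel> \<le> 1\<close>, and this is differentiability in the norm of the dual.

  Conversely a symmetric \<open>g\<close> is a closed 1-form on a ball, and the Poincare lemma gives the primitive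
  \<open>f(x) = \<integral>\<^sub>0\<^sup>1 g(tx)(x) dt\<close>. Differentiating under the integral along a segment, the symmetry turns
  the derivative of the integrand into the \<open>t\<close>-derivative of \<open>t g(tx)(h)\<close>, so that the directional derivative of \<open>f\<close> is
  \<open>g(x)(h)\<close> (\<open>radial_primitive_vector_derivative\<close>); since \<open>g\<close> is continuous, \<open>g(x)\<close> is the Frechet
  derivative (\<open>radial_primitive_has_derivative\<close>). The continuity needed to differentiate under the
  integral is that of the differentials of the scalar functions \<open>v \<mapsto> g(v)(a)\<close>, which holds because these
  differentials are themselves differentiable.
\<close>

section \<open>Cauchy estimates on complex lines\<close>

lemma Cauchy_estimates:
  fixes q :: "complex \<Rightarrow> complex"
  assumes holo: "q holomorphic_on ball 0 R" and R: "0 < R"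
    and bd: "\<And>z. norm z < R \<Longrightarrow> norm (q z) \<le> M"
  shows Cauchy_estimate_deriv: "norm (deriv q 0) \<le> 4 * M / R"
    and Cauchy_estimate_Taylor:
      "\<And>z. norm z \<le> R / 2 \<Longrightarrow> norm (q z - q 0 - deriv q 0 * z) \<le> 32 * M / R\<^sup>2 * (norm z)\<^sup>2"
proof -
  \<comment> \<open>Discs of radius \<open>R / 4\<close> about points of the closed disc of radius \<open>R / 2\<close> stay inside; the second
    derivative is thus at most \<open>2 M / (R / 4)\<^sup>2\<close> there, which gives the constant 32.\<close>
  have est: "norm ((deriv ^^ n) q w) \<le> fact n * M / (R / 4) ^ n" if w: "norm w \<le> R / 2" for n w
  proof (rule Cauchy_inequality)
    have sub: "cball w (R / 4) \<subseteq> ball 0 R"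
    proof
      fix x assume "x \<in> cball w (R / 4)"
      then have "norm x \<le> norm w + R / 4"
        using norm_triangle_ineq2[of x w] by (simp add: dist_norm norm_minus_commute)
      with w R show "x \<in> ball 0 R" by simp
    qed
    show "q holomorphic_on ball w (R / 4)"
      using holo sub ball_subset_cball by (blast intro: holomorphic_on_subset)
    show "continuous_on (cball w (R / 4)) q"
      using holo sub by (blast intro: holomorphic_on_imp_continuous_on continuous_on_subset)
    show "norm (q x) \<le> M" if "norm (w - x) = R / 4" for x
      using sub that by (intro bd) (auto simp: subset_iff dist_norm)
  qed (use R in simp)
  show "norm (deriv q 0) \<le> 4 * M / R"
    using est[of 0 1] R by (simp add: mult.commute)
  fix z :: complex assume z: "norm z \<le> R / 2"
  have "norm ((deriv ^^ 0) q z - (\<Sum>i\<le>1. (deriv ^^ i) q 0 * (z - 0) ^ i / fact i))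
      \<le> (32 * M / R\<^sup>2) * norm (z - 0) ^ Suc 1 / fact 1"
  proof (rule complex_Taylor[where S = "cball 0 (R / 2)"])
    show "((deriv ^^ i) q has_field_derivative (deriv ^^ Suc i) q x) (at x within cball 0 (R / 2))"
      if "x \<in> cball 0 (R / 2)" for i x
    proof -
      have "(deriv ^^ i) q holomorphic_on ball 0 R"
        using holo by (rule holomorphic_higher_deriv) simp
      moreover have "x \<in> ball 0 R" using that R by simp
      ultimately show ?thesis
        using holomorphic_derivI[OF _ open_ball] by simp
    qed
    show "norm ((deriv ^^ Suc 1) q x) \<le> 32 * M / R\<^sup>2" if "x \<in> cball 0 (R / 2)" for x
      using est[of x 2] that R by (simp add: numeral_2_eq_2 power2_eq_square)
  qed (use z R in auto)
  then show "norm (q z - q 0 - deriv q 0 * z) \<le> 32 * M / R\<^sup>2 * (norm z)\<^sup>2"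
    by (simp add: power2_eq_square diff_diff_eq)
qed

lemma scaleC_zero_left [simp]: "0 *\<^sub>C (x :: 'a::complex_normed_vector) = 0"
  using norm_scaleC[of 0 x] by simp

lemma scaleC_1 [simp]: "1 *\<^sub>C (x :: 'a::complex_normed_vector) = x"
  by (rule scaleC_one)

lemma bounded_linear_scaleC_left: "bounded_linear (\<lambda>z. z *\<^sub>C (x :: 'a::complex_normed_vector))"
  by (rule bounded_linear_intro[where K = "norm x"])
    (simp_all add: scaleC_add_left norm_scaleC scaleR_scaleC scaleC_scaleC scaleC_complex_def)

text \<open>
  The constants do not depend on the direction: the slice of \<open>p\<close> along \<open>h\<close> lives on a disc of radius
  \<open>s / \<parallel>h\<parallel>\<close>, which turns the one-variable estimates into bounds homogeneous in \<open>h\<close>. Only the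
  restriction of \<open>p\<close> to this one line has to be holomorphic, so the lemma applies to \<open>v \<mapsto> df(v)(h)\<close>
  before its differentiability is known.
\<close>

lemma slice_estimates:
  fixes p :: "'a::complex_normed_vector \<Rightarrow> complex"
  assumes s: "0 < s"
    and bd: "\<And>y. y \<in> ball v s \<Longrightarrow> norm (p y) \<le> M"
    and slice: "\<And>z. norm (z *\<^sub>C h) < s \<Longrightarrow>
      \<exists>d. ((\<lambda>z. p (v + z *\<^sub>C h)) has_field_derivative d) (at z)"
    and P: "((\<lambda>z. p (v + z *\<^sub>C h)) has_field_derivative P) (at 0)"
  shows slice_deriv_bound: "norm P \<le> 4 * M / s * norm h"
    and slice_Taylor_bound:
      "norm h \<le> s / 2 \<Longrightarrow> norm (p (v + h) - p v - P) \<le> 32 * M / s\<^sup>2 * (norm h)\<^sup>2"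
proof -
  define q where "q = (\<lambda>z. p (v + z *\<^sub>C h))"
  have dq: "deriv q 0 = P"
    using P unfolding q_def by (rule DERIV_imp_deriv)
  have "norm P \<le> 4 * M / s * norm h \<and>
    (norm h \<le> s / 2 \<longrightarrow> norm (p (v + h) - p v - P) \<le> 32 * M / s\<^sup>2 * (norm h)\<^sup>2)"
  proof (cases "h = 0")
    case True
    then have "P = 0" using dq by (simp add: q_def scaleC_zero_right)
    with True show ?thesis by simp
  next
    case False
    define R where "R = s / norm h"
    have R: "0 < R" using s False by (simp add: R_def)
    have lt: "norm (z *\<^sub>C h) < s" if "norm z < R" for z
      using that False by (simp add: R_def norm_scaleC pos_less_divide_eq)
    have holo: "q holomorphic_on ball 0 R"
      unfolding holomorphic_on_open[OF open_ball] q_def using slice lt by simp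
    have bq: "norm (q z) \<le> M" if "norm z < R" for z
      unfolding q_def using lt[OF that] by (intro bd) (simp add: dist_norm)
    have "norm P \<le> 4 * M / s * norm h"
      using Cauchy_estimate_deriv[OF holo R bq] by (simp add: dq R_def)
    moreover have "norm (p (v + h) - p v - P) \<le> 32 * M / s\<^sup>2 * (norm h)\<^sup>2" if "norm h \<le> s / 2"
    proof -
      have "norm (1 :: complex) \<le> R / 2" using that False by (simp add: R_def pos_le_divide_eq)
      from Cauchy_estimate_Taylor[OF holo R bq this]
      show ?thesis by (simp add: q_def dq[unfolded q_def] R_def power_divide)
    qed
    ultimately show ?thesis by blast
  qed
  then show "norm P \<le> 4 * M / s * norm h"
    and "norm h \<le> s / 2 \<Longrightarrow> norm (p (v + h) - p v - P) \<le> 32 * M / s\<^sup>2 * (norm h)\<^sup>2"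
    by blast+
qed

lemma bounded_clinear_scaleC:
  "bounded_clinear D \<Longrightarrow> D (c *\<^sub>C x) = c * D x" for D :: "'a::complex_normed_vector \<Rightarrow> complex"
  by (simp add: bounded_clinear_def scaleC_complex_def)

lemma slice_has_field_derivative:
  fixes f :: "'a::complex_normed_vector \<Rightarrow> complex"
  assumes D: "bounded_clinear D" and f: "(f has_derivative D) (at (v + z *\<^sub>C h))"
  shows "((\<lambda>z. f (v + z *\<^sub>C h)) has_field_derivative D h) (at z)"
proof -
  have "((\<lambda>z. v + z *\<^sub>C h) has_derivative (\<lambda>z. z *\<^sub>C h)) (at z)"
    by (auto intro!: derivative_eq_intros bounded_linear_imp_has_derivative bounded_linear_scaleC_left)
  from has_derivative_compose[OF this f] show ?thesis
    by (simp add: has_field_derivative_def bounded_clinear_scaleC[OF D] mult.commute[of _ "D h"])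
qed

section \<open>Second derivatives and their symmetry\<close>

text \<open>
  On a disc of the line through \<open>v\<close> in direction \<open>k\<close>, the quotients \<open>F n\<close> of \<open>f\<close> in direction \<open>h\<close> converge
  uniformly to \<open>D(\<cdot>)(h)\<close> by the Taylor bound, and their derivatives \<open>F' n\<close> are the quotients of
  \<open>D(\<cdot>)(k)\<close> in direction \<open>h\<close>. The second conjunct is kept because its limit is also the derivative
  with the roles of \<open>k\<close> and \<open>h\<close> exchanged.
\<close>

lemma mixed_derivative:
  fixes f :: "'a::complex_normed_vector \<Rightarrow> complex"
  assumes D: "\<And>v. v \<in> ball u (4 * r) \<Longrightarrow> bounded_clinear (D v)"
    and f: "\<And>v. v \<in> ball u (4 * r) \<Longrightarrow> (f has_derivative D v) (at v)"
    and bd: "\<And>v. v \<in> ball u (4 * r) \<Longrightarrow> norm (f v) \<le> M"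
    and r: "0 < r" and v: "v \<in> ball u (2 * r)"
    and c: "0 < c" "c * norm h \<le> r / 2"
  shows "\<exists>d. ((\<lambda>z. D (v + z *\<^sub>C k) h) has_field_derivative d) (at 0) \<and>
    (\<lambda>n. (D (v + complex_of_real (c / Suc n) *\<^sub>C h) k - D v k) / complex_of_real (c / Suc n))
      \<longlonglongrightarrow> d"
proof -
  define t where "t n = complex_of_real (c / Suc n)" for n
  have t0: "t n \<noteq> 0" for n using c by (simp add: t_def del: of_nat_Suc)
  have nt: "norm (t n) = c / Suc n" for n using c by (simp add: t_def norm_divide del: of_nat_Suc)
  have th: "norm (t n *\<^sub>C h) \<le> r / 2" for n
  proof -
    have "c / Suc n \<le> c" using c by (simp add: divide_le_eq)
    then have "norm (t n *\<^sub>C h) \<le> c * norm h"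
      unfolding norm_scaleC nt by (rule mult_right_mono) simp
    with c show ?thesis by simp
  qed
  define S where "S = {z. norm (z *\<^sub>C k) < r}"
  have S: "open S"
    unfolding S_def norm_scaleC by (intro open_Collect_less continuous_intros)
  have in3: "v + z *\<^sub>C k \<in> ball u (3 * r)" if "z \<in> S" for z
    using that v norm_triangle_ineq4[of "u - v" "z *\<^sub>C k"]
    by (auto simp: S_def dist_norm algebra_simps)
  have in4: "w + y \<in> ball u (4 * r)" if "w \<in> ball u (3 * r)" "norm y < r" for w y
    using that norm_triangle_ineq4[of "u - w" y] by (auto simp: dist_norm algebra_simps)
  have in4': "w \<in> ball u (4 * r)" if "w \<in> ball u (3 * r)" for w
    using in4[OF that, of 0] r by simp
  define F where "F n z = (f ((v + t n *\<^sub>C h) + z *\<^sub>C k) - f (v + z *\<^sub>C k)) / t n" for n z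
  define F' where "F' n z = (D ((v + t n *\<^sub>C h) + z *\<^sub>C k) k - D (v + z *\<^sub>C k) k) / t n" for n z
  have "\<exists>g'. \<forall>z \<in> S. ((\<lambda>z. D (v + z *\<^sub>C k) h) has_field_derivative g' z) (at z)
      \<and> (\<lambda>n. F' n z) \<longlonglongrightarrow> g' z"
  proof (rule has_complex_derivative_uniform_sequence[OF S, where f = F])
    fix n z assume z: "z \<in> S"
    have 1: "v + z *\<^sub>C k \<in> ball u (4 * r)" using in3[OF z] by (rule in4')
    have 2: "(v + t n *\<^sub>C h) + z *\<^sub>C k \<in> ball u (4 * r)"
      using in4[OF in3[OF z], of "t n *\<^sub>C h"] th[of n] r by (simp add: add_ac)
    show "(F n has_field_derivative F' n z) (at z)"
      unfolding F_def F'_def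
      by (intro DERIV_cdivide DERIV_diff slice_has_field_derivative D f 1 2)
  next
    fix x assume x: "x \<in> S"
    define C where "C = 32 * M / r\<^sup>2 * (norm h)\<^sup>2"
    have est: "norm (F n z - D (v + z *\<^sub>C k) h) \<le> C * norm (t n)" if z: "z \<in> S" for n z
    proof -
      define w where "w = v + z *\<^sub>C k"
      have w: "w \<in> ball u (3 * r)" unfolding w_def by (rule in3[OF z])
      have d: "((\<lambda>z. f (w + z *\<^sub>C (t n *\<^sub>C h))) has_field_derivative D (w + z *\<^sub>C (t n *\<^sub>C h)) (t n *\<^sub>C h)) (at z)"
        if "norm (z *\<^sub>C (t n *\<^sub>C h)) < r" for z
        by (intro slice_has_field_derivative D f in4 w that)
      have "norm (f (w + t n *\<^sub>C h) - f w - D w (t n *\<^sub>C h)) \<le> 32 * M / r\<^sup>2 * (norm (t n *\<^sub>C h))\<^sup>2"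
      proof (rule slice_Taylor_bound[OF r])
        show "norm (f y) \<le> M" if "y \<in> ball w r" for y
          using in4[OF w, of "y - w"] that by (intro bd) (simp add: dist_norm norm_minus_commute)
        show "((\<lambda>z. f (w + z *\<^sub>C (t n *\<^sub>C h))) has_field_derivative D w (t n *\<^sub>C h)) (at 0)"
          using d[of 0] r by simp
      qed (use d th in auto)
      moreover have "f (w + t n *\<^sub>C h) - f w - D w (t n *\<^sub>C h) = (F n z - D w h) * t n"
        using t0[of n]
        by (simp add: F_def w_def field_simps bounded_clinear_scaleC[OF D[OF in4'[OF w]], unfolded w_def])
      ultimately have "norm (F n z - D w h) * norm (t n) \<le> (C * norm (t n)) * norm (t n)"
        by (simp add: norm_mult norm_scaleC C_def power2_eq_square mult_ac)
      then show ?thesis unfolding w_def using t0[of n] by simp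
    qed
    have "uniform_limit S F (\<lambda>z. D (v + z *\<^sub>C k) h) sequentially"
    proof (rule uniform_limit_iff[THEN iffD2], intro allI impI)
      fix e :: real assume e: "0 < e"
      have "(\<lambda>n. C * norm (t n)) \<longlonglongrightarrow> C * 0"
        unfolding nt by (intro tendsto_mult tendsto_const LIMSEQ_Suc[OF lim_const_over_n])
      then have "\<forall>\<^sub>F n in sequentially. C * norm (t n) < e"
        using e by (intro order_tendstoD) auto
      then show "\<forall>\<^sub>F n in sequentially. \<forall>z\<in>S. dist (F n z) (D (v + z *\<^sub>C k) h) < e"
        by eventually_elim (use est in \<open>auto simp: dist_norm intro: le_less_trans\<close>)
    qed
    moreover obtain d where "0 < d" "cball x d \<subseteq> S"
      using S x open_contains_cball by blast
    ultimately show "\<exists>d>0. cball x d \<subseteq> S \<and> uniform_limit (cball x d) F (\<lambda>z. D (v + z *\<^sub>C k) h) sequentially"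
      using uniform_limit_on_subset by blast
  qed
  moreover have "0 \<in> S" using r by (simp add: S_def)
  ultimately show ?thesis unfolding F'_def t_def by fastforce
qed

text \<open>
  The derivative of \<open>D(\<cdot>)(h)\<close> in direction \<open>k\<close> is the limit of quotients of \<open>D(\<cdot>)(k)\<close> along some
  sequence of multiples of \<open>h\<close>; since \<open>D(\<cdot>)(k)\<close> does have a derivative in direction \<open>h\<close>, this limit
  can only be that derivative.
\<close>

lemma second_derivative_symmetric:
  fixes f :: "'a::complex_normed_vector \<Rightarrow> complex"
  assumes D: "\<And>v. v \<in> ball u (4 * r) \<Longrightarrow> bounded_clinear (D v)"
    and f: "\<And>v. v \<in> ball u (4 * r) \<Longrightarrow> (f has_derivative D v) (at v)"
    and bd: "\<And>v. v \<in> ball u (4 * r) \<Longrightarrow> norm (f v) \<le> M"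
    and r: "0 < r" and v: "v \<in> ball u (2 * r)"
  shows "\<exists>A. (\<forall>k h. ((\<lambda>z. D (v + z *\<^sub>C k) h) has_field_derivative A k h) (at 0)) \<and>
    (\<forall>k h. A k h = A h k)"
proof -
  have ex: "\<exists>d. ((\<lambda>z. D (v + z *\<^sub>C k) h) has_field_derivative d) (at 0) \<and>
      (\<exists>t. filterlim t (at 0) sequentially \<and>
        (\<lambda>n. (D (v + t n *\<^sub>C h) k - D v k) / t n) \<longlonglongrightarrow> d)" for k h
  proof -
    \<comment> \<open>Adding 1 to the norm keeps the step positive when \<open>h = 0\<close>.\<close>
    define c where "c = r / (2 * (1 + norm h))"
    have p: "0 < 1 + norm h" by (simp add: add_pos_nonneg)
    have c: "0 < c" "c * norm h \<le> r / 2"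
      using r p by (auto simp: c_def field_simps)
    have "(\<lambda>n. complex_of_real (c / Suc n)) \<longlonglongrightarrow> complex_of_real 0"
      by (intro tendsto_of_real LIMSEQ_Suc[OF lim_const_over_n])
    then have "filterlim (\<lambda>n. complex_of_real (c / Suc n)) (at 0) sequentially"
      using c by (intro filterlim_atI) (auto simp del: of_nat_Suc)
    with mixed_derivative[where f = f and D = D and M = M and k = k, OF D f bd r v c]
    show ?thesis by blast
  qed
  define A where "A k h = deriv (\<lambda>z. D (v + z *\<^sub>C k) h) 0" for k h
  have A: "((\<lambda>z. D (v + z *\<^sub>C k) h) has_field_derivative A k h) (at 0)" for k h
    using ex[of k h] unfolding A_def by (metis DERIV_imp_deriv)
  have "A k h = A h k" for k h
  proof -
    obtain d t where d: "((\<lambda>z. D (v + z *\<^sub>C k) h) has_field_derivative d) (at 0)"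
      and t: "filterlim t (at 0) sequentially"
      and lim: "(\<lambda>n. (D (v + t n *\<^sub>C h) k - D v k) / t n) \<longlonglongrightarrow> d"
      using ex[of k h] by blast
    have "((\<lambda>z. (D (v + z *\<^sub>C h) k - D v k) / z) \<longlongrightarrow> A h k) (at 0)"
      using A[of h k] by (simp add: has_field_derivative_iff)
    then have "(\<lambda>n. (D (v + t n *\<^sub>C h) k - D v k) / t n) \<longlonglongrightarrow> A h k"
      using t by (rule filterlim_compose)
    with lim have "d = A h k" by (rule LIMSEQ_unique)
    moreover have "d = A k h" using d A by (rule DERIV_unique)
    ultimately show ?thesis by simp
  qed
  with A show ?thesis by blast
qed

section \<open>The differential of a holomorphic function is holomorphic\<close>

lemma holomorphic_on_ball_frechet:
  assumes "holomorphic_on_ball f" "u \<in> ball 0 1"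
  shows bounded_clinear_frechet_derivative: "bounded_clinear (frechet_derivative f (at u))"
    and has_derivative_frechet_derivative: "(f has_derivative frechet_derivative f (at u)) (at u)"
  using assms unfolding holomorphic_on_ball_def by (metis frechet_derivative_at)+

lemma cdual_apply_Cdual: "bounded_clinear D \<Longrightarrow> cdual_apply (Cdual D) = D"
  by (simp add: Cdual_inverse)

lemma cdual_apply_differential:
  "holomorphic_on_ball f \<Longrightarrow> u \<in> ball 0 1 \<Longrightarrow>
    cdual_apply (differential f u) = frechet_derivative f (at u)"
  by (simp add: differential_def cdual_apply_Cdual bounded_clinear_frechet_derivative del: mem_ball)

lemma has_derivative_differential:
  "holomorphic_on_ball f \<Longrightarrow> u \<in> ball 0 1 \<Longrightarrow>
    (f has_derivative cdual_apply (differential f u)) (at u)"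
  by (simp add: cdual_apply_differential has_derivative_frechet_derivative del: mem_ball)

lemma norm_cdual_apply_le: "norm (cdual_apply \<phi> x) \<le> norm \<phi> * norm x"
  unfolding norm_cdual.rep_eq by (rule onorm[OF bounded_linear_cdual_apply])

lemma norm_cdual_leI:
  "0 \<le> K \<Longrightarrow> (\<And>x. norm (cdual_apply \<phi> x) \<le> K * norm x) \<Longrightarrow> norm \<phi> \<le> K"
  unfolding norm_cdual.rep_eq by (rule onorm_bound)

lemma cdual_eqI: "(\<And>x. cdual_apply \<phi> x = cdual_apply \<psi> x) \<Longrightarrow> \<phi> = \<psi>"
  by (simp add: cdual_apply_inject[symmetric] fun_eq_iff)

lemma bounded_linear_cdual_eval: "bounded_linear (\<lambda>\<phi>. cdual_apply \<phi> x)"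
  by (rule bounded_linear_intro[where K = "norm x"])
    (simp_all add: plus_cdual.rep_eq scaleR_cdual_def scaleC_cdual.rep_eq scaleC_complex_def
      scaleR_conv_of_real norm_cdual_apply_le)

text \<open>
  Local boundedness of \<open>f\<close>, which continuity provides, is all that the Cauchy estimates use. They bound
  \<open>D(v)(h)\<close> by \<open>K \<parallel>h\<parallel>\<close> near \<open>u\<close>; a second application, to \<open>v \<mapsto> D(v)(h)\<close>, shows that the form \<open>A\<close> of
  second derivatives is bounded and that \<open>D(u + k)(h) - D(u)(h) - A(k,h)\<close> is at most a constant
  times \<open>\<parallel>h\<parallel> \<parallel>k\<parallel>\<^sup>2\<close>.
\<close>

theorem differential_has_symmetric_derivative:
  fixes f :: "'a::complex_banach \<Rightarrow> complex"
  assumes f: "holomorphic_on_ball f" and u: "u \<in> ball 0 1"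
  shows "\<exists>G. bounded_clinear G \<and> (differential f has_derivative G) (at u) \<and>
    (\<forall>k h. cdual_apply (G k) h = cdual_apply (G h) k)"
proof -
  define D where "D v = cdual_apply (differential f v)" for v
  have D: "bounded_clinear (D v)" for v
    unfolding D_def by (rule bounded_clinear_cdual_apply)
  obtain d1 where d1: "0 < d1" "ball u d1 \<subseteq> ball 0 1"
    using u open_ball open_contains_ball by blast
  have "isCont f u"
    using has_derivative_differential[OF f u] by (rule has_derivative_continuous)
  then obtain d2 where d2: "0 < d2" "\<And>v. dist v u < d2 \<Longrightarrow> dist (f v) (f u) < 1"
    unfolding continuous_at by (metis LIM_def dist_self zero_less_one)
  define r where "r = min d1 d2 / 4"
  define M where "M = norm (f u) + 1"
  have r: "0 < r" using d1 d2 by (simp add: r_def)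
  have Df: "(f has_derivative D v) (at v)" if "v \<in> ball u (4 * r)" for v
  proof -
    have "v \<in> ball 0 1" using that d1 by (auto simp: r_def subset_iff)
    then show ?thesis unfolding D_def by (rule has_derivative_differential[OF f])
  qed
  have bd: "norm (f v) \<le> M" if "v \<in> ball u (4 * r)" for v
  proof -
    have "dist (f v) (f u) < 1" using that by (intro d2) (simp add: r_def dist_commute)
    then show ?thesis
      using norm_triangle_ineq2[of "f v" "f u"] by (simp add: M_def dist_norm)
  qed
  have second: "\<exists>A. (\<forall>k h. ((\<lambda>z. D (v + z *\<^sub>C k) h) has_field_derivative A k h) (at 0)) \<and>
      (\<forall>k h. A k h = A h k)" if "v \<in> ball u (2 * r)" for v
    by (rule second_derivative_symmetric[where f = f and M = M, OF D Df bd r that])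
  obtain A where A: "\<And>k h. ((\<lambda>z. D (u + z *\<^sub>C k) h) has_field_derivative A k h) (at 0)"
    and sym: "\<And>k h. A k h = A h k"
    using second[of u] r by auto
  \<comment> \<open>The derivative at another point \<open>z\<close> of the line is the derivative at 0 with the base point moved
    to \<open>u + z k\<close>.\<close>
  have slice: "\<exists>d. ((\<lambda>z. D (u + z *\<^sub>C k) h) has_field_derivative d) (at z)"
    if "norm (z *\<^sub>C k) < r" for z k h
  proof -
    have "u + z *\<^sub>C k \<in> ball u (2 * r)" using that r by (simp add: dist_norm)
    from second[OF this] obtain d where
      "((\<lambda>w. D ((u + z *\<^sub>C k) + w *\<^sub>C k) h) has_field_derivative d) (at 0)" by blast
    then have "((\<lambda>w. D (u + (w + z) *\<^sub>C k) h) has_field_derivative d) (at 0)"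
      by (simp add: scaleC_add_left add_ac)
    then show ?thesis
      using DERIV_shift[of "\<lambda>w. D (u + w *\<^sub>C k) h" d 0 z] by auto
  qed
  define K where "K = 4 * M / r"
  have K: "0 \<le> K" using r by (simp add: K_def M_def add_nonneg_nonneg)
  have Dbd: "norm (D v h) \<le> K * norm h" if v: "v \<in> ball u r" for v h
  proof -
    have in4: "y \<in> ball u (4 * r)" if "y \<in> ball v r" for y
      using that v r dist_triangle[of u y v] by simp
    have d: "((\<lambda>z. f (v + z *\<^sub>C h)) has_field_derivative D (v + z *\<^sub>C h) h) (at z)"
      if "norm (z *\<^sub>C h) < r" for z
      using that by (intro slice_has_field_derivative D Df in4) (simp add: dist_norm)
    show ?thesis unfolding K_def
    proof (rule slice_deriv_bound[OF r])
      show "((\<lambda>z. f (v + z *\<^sub>C h)) has_field_derivative D v h) (at 0)"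
        using d[of 0] r by simp
    qed (use d bd in4 in auto)
  qed
  have Abd: "norm (A k h) \<le> 4 * K / r * norm k * norm h" for k h
  proof -
    have "norm (A k h) \<le> 4 * (K * norm h) / r * norm k"
      by (rule slice_deriv_bound[OF r, where p = "\<lambda>v. D v h", OF Dbd slice A])
    then show ?thesis by (simp add: mult_ac)
  qed
  have ATay: "norm (D (u + k) h - D u h - A k h) \<le> 32 * (K * norm h) / r\<^sup>2 * (norm k)\<^sup>2"
    if "norm k \<le> r / 2" for k h
    by (rule slice_Taylor_bound[OF r, where p = "\<lambda>v. D v h", OF Dbd slice A that])
  have A_add: "A k (h + h') = A k h + A k h'" for k h h'
  proof (rule DERIV_unique[OF A])
    have "D v (h + h') = D v h + D v h'" for v
      using D[of v] by (simp add: bounded_clinear_def linear_simps)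
    then show "((\<lambda>z. D (u + z *\<^sub>C k) (h + h')) has_field_derivative A k h + A k h') (at 0)"
      by (simp add: DERIV_add A)
  qed
  have A_scale: "A k (c *\<^sub>C h) = c * A k h" for k c h
  proof (rule DERIV_unique[OF A])
    show "((\<lambda>z. D (u + z *\<^sub>C k) (c *\<^sub>C h)) has_field_derivative c * A k h) (at 0)"
      unfolding bounded_clinear_scaleC[OF D] by (rule DERIV_cmult[OF A])
  qed
  have A_scaleR: "A k (c *\<^sub>R h) = c *\<^sub>R A k h" for k c h
    by (simp add: scaleR_scaleC[where 'a = 'a] A_scale scaleR_conv_of_real)
  have Acl: "bounded_clinear (A k)" for k
    unfolding bounded_clinear_def
    using Abd[of k]
    by (intro conjI bounded_linear_intro[where K = "4 * K / r * norm k"])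
      (simp_all add: A_add A_scale A_scaleR scaleC_complex_def mult_ac)
  define G where "G k = Cdual (A k)" for k
  have G: "cdual_apply (G k) h = A k h" for k h
    by (simp add: G_def cdual_apply_Cdual[OF Acl])
  \<comment> \<open>Each form \<open>A k\<close> is linear because \<open>D v\<close> is; linearity in \<open>k\<close> is available only through the
    symmetry of \<open>A\<close>.\<close>
  have "bounded_linear G"
  proof (rule bounded_linear_intro[where K = "4 * K / r"])
    show "G (k + k') = G k + G k'" for k k'
      by (rule cdual_eqI) (simp add: plus_cdual.rep_eq G sym[of _ h for h] A_add)
    show "G (c *\<^sub>R k) = c *\<^sub>R G k" for c k
      by (rule cdual_eqI)
        (simp add: scaleR_cdual_def scaleC_cdual.rep_eq G sym[of _ h for h] A_scaleR
          scaleC_complex_def scaleR_conv_of_real)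
    show "norm (G k) \<le> norm k * (4 * K / r)" for k
      using K r Abd[of k] by (intro norm_cdual_leI) (auto simp: G mult_ac)
  qed
  moreover have "G (c *\<^sub>C k) = c *\<^sub>C G k" for c k
    by (rule cdual_eqI)
      (simp add: scaleC_cdual.rep_eq G sym[of _ h for h] A_scale scaleC_complex_def)
  ultimately have Gcl: "bounded_clinear G" by (simp add: bounded_clinear_def)
  have "(differential f has_derivative G) (at u)"
  proof (rule has_derivativeI_sandwich)
    show "0 < r / 2" using r by simp
    show "bounded_linear G" by fact
    fix y assume y: "y \<noteq> u" "dist y u < r / 2"
    define k where "k = y - u"
    have k: "norm k \<le> r / 2" "y = u + k" "k \<noteq> 0" using y by (simp_all add: k_def dist_norm)
    have "norm (differential f y - differential f u - G k) \<le> 32 * K / r\<^sup>2 * (norm k)\<^sup>2"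
    proof (rule norm_cdual_leI)
      fix h
      show "norm (cdual_apply (differential f y - differential f u - G k) h)
          \<le> 32 * K / r\<^sup>2 * (norm k)\<^sup>2 * norm h"
        using ATay[OF k(1), of h] by (simp add: minus_cdual.rep_eq G D_def k(2) mult_ac)
    qed (use K in simp)
    then show "norm (differential f y - differential f u - G (y - u)) / norm (y - u)
        \<le> 32 * K / r\<^sup>2 * norm (y - u)"
      using k(3) unfolding k_def[symmetric] by (simp add: divide_le_eq power2_eq_square mult_ac)
  next
    have "((\<lambda>y. 32 * K / r\<^sup>2 * norm (y - u)) \<longlongrightarrow> 32 * K / r\<^sup>2 * norm (u - u)) (at u)"
      by (intro tendsto_intros)
    then show "((\<lambda>y. 32 * K / r\<^sup>2 * norm (y - u)) \<longlongrightarrow> 0) (at u)" by simp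
  qed
  moreover have "cdual_apply (G k) h = cdual_apply (G h) k" for k h
    by (simp only: G sym[of k h])
  ultimately show ?thesis using Gcl by blast
qed

section \<open>The Lipschitz norm is the supremum norm of the differential\<close>

lemma cdual_apply_add_right: "cdual_apply \<phi> (x + y) = cdual_apply \<phi> x + cdual_apply \<phi> y"
  by (rule linear_add[OF bounded_linear.linear[OF bounded_linear_cdual_apply]])

lemma cdual_apply_scaleR_right: "cdual_apply \<phi> (r *\<^sub>R x) = r *\<^sub>R cdual_apply \<phi> x"
  by (rule linear_scale[OF bounded_linear.linear[OF bounded_linear_cdual_apply]])

lemma lipschitz_bound_imp_differential_bound:
  fixes f :: "'a::complex_banach \<Rightarrow> complex"
  assumes f: "holomorphic_on_ball f" and u: "u \<in> ball 0 1" and K: "0 \<le> K"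
    and lip: "\<And>x y. x \<in> ball 0 1 \<Longrightarrow> y \<in> ball 0 1 \<Longrightarrow> norm (f x - f y) \<le> K * norm (x - y)"
  shows "norm (differential f u) \<le> K"
proof (rule norm_cdual_leI[OF K])
  fix h
  have "((\<lambda>z. f (u + z *\<^sub>C h)) has_field_derivative cdual_apply (differential f u) h) (at 0)"
    using has_derivative_differential[OF f u]
    by (intro slice_has_field_derivative bounded_clinear_cdual_apply) simp
  then have lim: "((\<lambda>z. (f (u + z *\<^sub>C h) - f u) / z) \<longlongrightarrow> cdual_apply (differential f u) h) (at 0)"
    by (simp add: has_field_derivative_iff)
  have "((\<lambda>z. u + z *\<^sub>C h) \<longlongrightarrow> u + 0 *\<^sub>C h) (at 0)"
    by (intro tendsto_intros bounded_linear.tendsto[OF bounded_linear_scaleC_left])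
  then have "\<forall>\<^sub>F z in at 0. u + z *\<^sub>C h \<in> ball 0 1"
    using u by (intro topological_tendstoD[OF _ open_ball]) simp_all
  moreover have "\<forall>\<^sub>F z in at (0 :: complex). z \<noteq> 0"
    by (rule eventually_neq_at_within)
  ultimately have "\<forall>\<^sub>F z in at 0. norm ((f (u + z *\<^sub>C h) - f u) / z) \<le> K * norm h"
  proof eventually_elim
    case (elim z)
    then show ?case
      using lip[OF elim(1) u] by (simp add: norm_divide norm_scaleC divide_le_eq mult_ac)
  qed
  then show "norm (cdual_apply (differential f u) h) \<le> K * norm h"
    by (rule Lim_norm_ubound[OF trivial_limit_at lim])
qed

lemma differential_bound_imp_lipschitz_bound:
  fixes f :: "'a::complex_banach \<Rightarrow> complex"
  assumes f: "holomorphic_on_ball f"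
    and K: "\<And>u. u \<in> ball 0 1 \<Longrightarrow> norm (differential f u) \<le> K"
    and xy: "x \<in> ball 0 1" "y \<in> ball 0 1"
  shows "norm (f x - f y) \<le> K * norm (x - y)"
proof (rule differentiable_bound[OF convex_ball _ _ xy])
  fix u :: 'a assume u: "u \<in> ball 0 1"
  show "(f has_derivative cdual_apply (differential f u)) (at u within ball 0 1)"
    using has_derivative_differential[OF f u] by (rule has_derivative_at_withinI)
  show "onorm (cdual_apply (differential f u)) \<le> K"
    using K[OF u] by (simp add: norm_cdual.rep_eq)
qed

lemma bdd_above_difference_quotients:
  assumes "f \<in> HL0"
  shows "bdd_above (insert 0
    {cmod (f x - f y) / norm (x - y) | x y. x \<in> ball 0 1 \<and> y \<in> ball 0 1 \<and> x \<noteq> y})"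
proof -
  obtain K where K: "K-lipschitz_on (ball 0 1) f" using assms by (auto simp: HL0_def)
  show ?thesis
    using lipschitz_onD[OF K] lipschitz_on_nonneg[OF K]
    by (intro bdd_aboveI[where M = K]) (auto simp: dist_norm divide_le_eq)
qed

lemma lip_norm_nonneg: "f \<in> HL0 \<Longrightarrow> 0 \<le> lip_norm f"
  unfolding lip_norm_def by (rule cSup_upper[OF _ bdd_above_difference_quotients]) simp_all

lemma lip_norm_bound:
  assumes f: "f \<in> HL0" and xy: "x \<in> ball 0 1" "y \<in> ball 0 1"
  shows "norm (f x - f y) \<le> lip_norm f * norm (x - y)"
proof (cases "x = y")
  case False
  then have "cmod (f x - f y) / norm (x - y) \<le> lip_norm f"
    unfolding lip_norm_def using xy
    by (intro cSup_upper[OF _ bdd_above_difference_quotients[OF f]]) blast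
  with False show ?thesis by (simp add: divide_le_eq)
qed simp

lemma lip_norm_least:
  assumes "0 \<le> K"
    and "\<And>x y. x \<in> ball 0 1 \<Longrightarrow> y \<in> ball 0 1 \<Longrightarrow> norm (f x - f y) \<le> K * norm (x - y)"
  shows "lip_norm f \<le> K"
  unfolding lip_norm_def using assms by (intro cSup_least) (auto simp: divide_le_eq)

lemma norm_le_Hinf_norm: "bounded (g ` ball 0 1) \<Longrightarrow> u \<in> ball 0 1 \<Longrightarrow> norm (g u) \<le> Hinf_norm g"
  unfolding Hinf_norm_def
  by (rule cSUP_upper) (auto simp: bounded_iff bdd_above_def)

lemma Hinf_norm_least: "(\<And>u. u \<in> ball 0 1 \<Longrightarrow> norm (g u) \<le> K) \<Longrightarrow> Hinf_norm g \<le> K"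
  unfolding Hinf_norm_def by (rule cSUP_least) auto

lemma HL0_holomorphic: "f \<in> HL0 \<Longrightarrow> holomorphic_on_ball f"
  by (simp add: HL0_def Hinf_def)

lemma differential_norm_le_lip_norm:
  "f \<in> HL0 \<Longrightarrow> u \<in> ball 0 1 \<Longrightarrow> norm (differential f u) \<le> lip_norm f"
  by (intro lipschitz_bound_imp_differential_bound HL0_holomorphic lip_norm_nonneg lip_norm_bound)

lemma bounded_differential: "f \<in> HL0 \<Longrightarrow> bounded (differential f ` ball 0 1)"
  using differential_norm_le_lip_norm by (intro boundedI) blast

lemma Hinf_norm_differential:
  assumes f: "f \<in> HL0"
  shows "Hinf_norm (differential f) = lip_norm f"
proof (rule antisym)
  show "Hinf_norm (differential f) \<le> lip_norm f"
    using f by (intro Hinf_norm_least differential_norm_le_lip_norm)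
  have le: "norm (differential f u) \<le> Hinf_norm (differential f)" if "u \<in> ball 0 1" for u
    using bounded_differential[OF f] that by (rule norm_le_Hinf_norm)
  show "lip_norm f \<le> Hinf_norm (differential f)"
  proof (rule lip_norm_least)
    show "0 \<le> Hinf_norm (differential f)"
      using order_trans[OF norm_ge_zero le[of 0]] by simp
  qed (intro differential_bound_imp_lipschitz_bound HL0_holomorphic f le)
qed

section \<open>Symmetric holomorphic maps have primitives\<close>

lemma evaluation_has_derivative:
  "(g has_derivative G) F \<Longrightarrow> ((\<lambda>v. cdual_apply (g v) x) has_derivative (\<lambda>k. cdual_apply (G k) x)) F"
  by (rule bounded_linear.has_derivative[OF bounded_linear_cdual_eval])

lemma holomorphic_on_ball_evaluation:
  assumes "holomorphic_on_ball g"
  shows "holomorphic_on_ball (\<lambda>v. cdual_apply (g v) x)"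
  unfolding holomorphic_on_ball_def
proof
  fix u :: 'a assume "u \<in> ball 0 1"
  then obtain G where G: "bounded_clinear G" "(g has_derivative G) (at u)"
    using assms unfolding holomorphic_on_ball_def by blast
  have "bounded_clinear (\<lambda>k. cdual_apply (G k) x)"
    using G(1) bounded_linear_compose[OF bounded_linear_cdual_eval]
    by (auto simp: bounded_clinear_def scaleC_cdual.rep_eq)
  with evaluation_has_derivative[OF G(2)]
  show "\<exists>D. bounded_clinear D \<and> ((\<lambda>v. cdual_apply (g v) x) has_derivative D) (at u)" by blast
qed

definition radial_primitive :: "('a::complex_banach \<Rightarrow> 'a cdual) \<Rightarrow> 'a \<Rightarrow> complex"
  where "radial_primitive g x = integral {0..1} (\<lambda>t. cdual_apply (g (t *\<^sub>R x)) x)"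

lemma scaleR_in_ball: "y \<in> ball 0 1 \<Longrightarrow> t \<in> {0..1} \<Longrightarrow> t *\<^sub>R y \<in> ball (0 :: 'a::real_normed_vector) 1"
  using mult_left_le_one_le[of "norm y" t] by simp

text \<open>
  Write \<open>\<psi> a\<close> for \<open>v \<mapsto> g(v)(a)\<close> and \<open>e a\<close> for its differential, and put \<open>p = t (x + s h)\<close>. The
  \<open>s\<close>-derivative of the integrand \<open>g(p)(x + s h) = \<psi> x p + s \<psi> h p\<close> contains \<open>e x p h\<close>, which the
  symmetry replaces by \<open>e h p x\<close>. The result is \<open>\<psi> h p + t e h p (x + s h)\<close>, the \<open>t\<close>-derivative of
  \<open>t \<psi> h p\<close>, and this integrates to \<open>\<psi> h (x + s h)\<close>.
\<close>

lemma radial_primitive_vector_derivative: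
  assumes g: "g \<in> Hinf_s" and U: "convex U" "s0 \<in> U"
    and line: "\<And>s. s \<in> U \<Longrightarrow> x + s *\<^sub>R h \<in> ball 0 1"
  shows "((\<lambda>s. radial_primitive g (x + s *\<^sub>R h)) has_vector_derivative
    cdual_apply (g (x + s0 *\<^sub>R h)) h) (at s0 within U)"
proof -
  define \<psi> where "\<psi> a v = cdual_apply (g v) a" for a v
  define e where "e a v = cdual_apply (differential (\<psi> a) v)" for a v
  have holg: "holomorphic_on_ball g" using g by (simp add: Hinf_s_def Hinf_def)
  have hol\<psi>: "holomorphic_on_ball (\<psi> a)" for a
    unfolding \<psi>_def by (rule holomorphic_on_ball_evaluation[OF holg])
  have d\<psi>: "(\<psi> a has_derivative e a v) (at v)" if "v \<in> ball 0 1" for a v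
    unfolding e_def using hol\<psi> that by (rule has_derivative_differential)
  have sym: "e a v b = e b v a" if v: "v \<in> ball 0 1" for a b v
    using g v unfolding e_def cdual_apply_differential[OF hol\<psi> v] unfolding \<psi>_def Hinf_s_def by blast
  have e_add: "e a v (b + c) = e a v b + e a v c" and e_scale: "e a v (r *\<^sub>R b) = r *\<^sub>R e a v b"
    for a v b c r
    by (simp_all add: e_def cdual_apply_add_right cdual_apply_scaleR_right)
  have cont_\<psi>: "continuous_on (ball 0 1) (\<psi> a)" for a
    using d\<psi> by (intro continuous_at_imp_continuous_on ballI has_derivative_continuous)
  have cont_e: "continuous_on (ball 0 1) (\<lambda>v. e a v b)" for a b
  proof -
    have "continuous_on (ball 0 1) (differential (\<psi> a))"
      using differential_has_symmetric_derivative[OF hol\<psi>]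
      by (intro continuous_at_imp_continuous_on ballI) (blast intro: has_derivative_continuous)
    then show ?thesis
      unfolding e_def by (rule bounded_linear.continuous_on[OF bounded_linear_cdual_eval])
  qed
  define p where "p s t = t *\<^sub>R (x + s *\<^sub>R h)" for s t
  have p: "p s t \<in> ball 0 1" if "s \<in> U" "t \<in> {0..1}" for s t
    unfolding p_def using line[OF that(1)] that(2) by (rule scaleR_in_ball)
  \<comment> \<open>The term \<open>e h p (x + s h)\<close> is expanded by linearity, so that the joint continuity in \<open>(s, t)\<close>
    involves \<open>e h\<close> at a moving point but only in the fixed directions \<open>x\<close> and \<open>h\<close>.\<close>
  define fx where "fx s t = \<psi> h (p s t) + t *\<^sub>R (e h (p s t) x + s *\<^sub>R e h (p s t) h)" for s t
  have dp: "((\<lambda>s. \<psi> a (p s t)) has_vector_derivative e a (p s t) (t *\<^sub>R h)) (at s within U)"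
    if "s \<in> U" "t \<in> {0..1}" for a s t
  proof -
    have 1: "((\<lambda>s. p s t) has_vector_derivative t *\<^sub>R h) (at s within U)"
      unfolding p_def by (auto intro!: derivative_eq_intros simp: has_vector_derivative_def)
    from vector_derivative_diff_chain_within[OF 1 has_derivative_at_withinI[OF d\<psi>[OF p[OF that]]]]
    show ?thesis by (simp add: o_def)
  qed
  have split: "cdual_apply (g (p s t)) (x + s *\<^sub>R h) = \<psi> x (p s t) + s *\<^sub>R \<psi> h (p s t)" for s t
    by (simp add: \<psi>_def cdual_apply_add_right cdual_apply_scaleR_right)
  have "((\<lambda>s. integral (cbox 0 1) (\<lambda>t. cdual_apply (g (p s t)) (x + s *\<^sub>R h))) has_vector_derivative
      integral (cbox 0 1) (fx s0)) (at s0 within U)"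
  proof (rule leibniz_rule_vector_derivative[OF _ _ _ U(2) U(1)])
    fix s t :: real assume s: "s \<in> U" and "t \<in> cbox 0 1"
    then have t: "t \<in> {0..1}" by simp
    have "((\<lambda>s. \<psi> x (p s t) + s *\<^sub>R \<psi> h (p s t)) has_vector_derivative
       e x (p s t) (t *\<^sub>R h) + (s *\<^sub>R e h (p s t) (t *\<^sub>R h) + 1 *\<^sub>R \<psi> h (p s t))) (at s within U)"
      by (intro has_vector_derivative_add has_vector_derivative_scaleR dp s t DERIV_ident)
    then show "((\<lambda>s. cdual_apply (g (p s t)) (x + s *\<^sub>R h)) has_vector_derivative fx s t) (at s within U)"
      unfolding split
      by (rule has_vector_derivative_eq_rhs)
        (simp add: fx_def e_scale sym[OF p[OF s t], of x] algebra_simps)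
  next
    fix s assume s: "s \<in> U"
    have "continuous_on {0..1} (\<lambda>t. \<psi> x (p s t) + s *\<^sub>R \<psi> h (p s t))"
      unfolding p_def
      by (intro continuous_intros continuous_on_compose2[OF cont_\<psi>])
        (use p[OF s] in \<open>auto simp: p_def simp del: mem_ball\<close>)
    then show "(\<lambda>t. cdual_apply (g (p s t)) (x + s *\<^sub>R h)) integrable_on cbox 0 1"
      unfolding split by (simp add: integrable_continuous_real)
  next
    have pc: "continuous_on (U \<times> cbox 0 1) (\<lambda>z. p (fst z) (snd z))"
      unfolding p_def by (intro continuous_intros)
    have pi: "(\<lambda>z. p (fst z) (snd z)) ` (U \<times> cbox 0 1) \<subseteq> ball 0 1"
      using p by (auto simp del: mem_ball)
    show "continuous_on (U \<times> cbox 0 1) (\<lambda>(s, t). fx s t)"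
      unfolding fx_def split_beta
      by (intro continuous_intros continuous_on_compose2[OF cont_\<psi> pc pi]
          continuous_on_compose2[OF cont_e pc pi])
  qed
  moreover have "integral (cbox 0 1) (fx s0) = \<psi> h (x + s0 *\<^sub>R h)"
  proof -
    have "(fx s0 has_integral 1 *\<^sub>R \<psi> h (p s0 1) - 0 *\<^sub>R \<psi> h (p s0 0)) {0..1}"
    proof (rule fundamental_theorem_of_calculus)
      fix t :: real assume t: "t \<in> {0..1}"
      have 1: "((\<lambda>t. p s0 t) has_vector_derivative x + s0 *\<^sub>R h) (at t within {0..1})"
        unfolding p_def by (auto intro!: derivative_eq_intros simp: has_vector_derivative_def)
      have "((\<lambda>t. \<psi> h (p s0 t)) has_vector_derivative e h (p s0 t) (x + s0 *\<^sub>R h)) (at t within {0..1})"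
        using vector_derivative_diff_chain_within[OF 1 has_derivative_at_withinI[OF d\<psi>[OF p[OF U(2) t]]]]
        by (simp add: o_def)
      then have "((\<lambda>t. t *\<^sub>R \<psi> h (p s0 t)) has_vector_derivative
          t *\<^sub>R e h (p s0 t) (x + s0 *\<^sub>R h) + 1 *\<^sub>R \<psi> h (p s0 t)) (at t within {0..1})"
        by (intro has_vector_derivative_scaleR DERIV_ident)
      then show "((\<lambda>t. t *\<^sub>R \<psi> h (p s0 t)) has_vector_derivative fx s0 t) (at t within {0..1})"
        by (rule has_vector_derivative_eq_rhs) (simp add: fx_def e_add e_scale)
    qed simp
    then show ?thesis by (simp add: integral_unique p_def)
  qed
  ultimately show ?thesis by (simp add: radial_primitive_def p_def \<psi>_def)
qed

text \<open>
  Along the segment from \<open>x\<close> to \<open>x + h\<close> the derivative \<open>g(x + s h)(h)\<close> differs from \<open>g(x)(h)\<close> by at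
  most \<open>e \<parallel>h\<parallel>\<close> once \<open>h\<close> is small, by continuity of \<open>g\<close>; the mean value inequality then gives the
  Frechet derivative.
\<close>

lemma radial_primitive_has_derivative:
  assumes g: "g \<in> Hinf_s" and x: "x \<in> ball 0 1"
  shows "(radial_primitive g has_derivative cdual_apply (g x)) (at x)"
  unfolding has_derivative_at_alt
proof (intro conjI allI impI bounded_linear_cdual_apply)
  fix e :: real assume e: "0 < e"
  obtain d1 where d1: "0 < d1" "ball x d1 \<subseteq> ball 0 1"
    using x open_ball open_contains_ball by blast
  have "isCont g x"
    using g x unfolding Hinf_s_def Hinf_def holomorphic_on_ball_def
    by (blast intro: has_derivative_continuous)
  then obtain d2 where d2: "0 < d2" "\<And>v. dist v x < d2 \<Longrightarrow> dist (g v) (g x) < e"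
    unfolding continuous_at using e by (metis LIM_def dist_self)
  show "\<exists>d>0. \<forall>y. norm (y - x) < d \<longrightarrow>
    norm (radial_primitive g y - radial_primitive g x - cdual_apply (g x) (y - x)) \<le> e * norm (y - x)"
  proof (intro exI[of _ "min d1 d2"] conjI allI impI)
    fix y assume y: "norm (y - x) < min d1 d2"
    define h where "h = y - x"
    have seg: "dist (x + s *\<^sub>R h) x < min d1 d2" if "s \<in> {0..1}" for s
      using that y mult_left_le_one_le[of "norm h" s] by (simp add: dist_norm h_def)
    have line: "x + s *\<^sub>R h \<in> ball 0 1" if "s \<in> {0..1}" for s
      using seg[OF that] d1 by (auto simp: subset_iff dist_commute)
    have "norm (radial_primitive g (x + 1 *\<^sub>R h) - radial_primitive g (x + 0 *\<^sub>R h)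
        - (1 - 0) *\<^sub>R cdual_apply (g (x + 0 *\<^sub>R h)) h) \<le> norm (1 - 0 :: real) * (e * norm h)"
    proof (rule vector_differentiable_bound_linearization)
      fix s :: real assume s: "s \<in> {0..1}"
      show "((\<lambda>s. radial_primitive g (x + s *\<^sub>R h)) has_vector_derivative
          cdual_apply (g (x + s *\<^sub>R h)) h) (at s within {0..1})"
        using s by (intro radial_primitive_vector_derivative[OF g] line) auto
      have "norm (g (x + s *\<^sub>R h) - g x) \<le> e"
        using d2(2)[of "x + s *\<^sub>R h"] seg[OF s] by (simp add: dist_norm)
      then have "norm (cdual_apply (g (x + s *\<^sub>R h) - g x) h) \<le> e * norm h"
        by (intro order_trans[OF norm_cdual_apply_le] mult_right_mono) simp_all
      then show "norm (cdual_apply (g (x + s *\<^sub>R h)) h - cdual_apply (g (x + 0 *\<^sub>R h)) h) \<le> e * norm h"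
        by (simp add: minus_cdual.rep_eq)
    qed (auto simp: closed_segment_eq_real_ivl)
    then show "norm (radial_primitive g y - radial_primitive g x - cdual_apply (g x) (y - x))
        \<le> e * norm (y - x)"
      by (simp add: h_def)
  qed (use d1 d2 in simp)
qed

lemma differential_eqI:
  assumes f: "\<And>u. u \<in> ball 0 1 \<Longrightarrow> (f has_derivative cdual_apply (g u)) (at u)"
    and g: "\<And>u. u \<notin> ball 0 1 \<Longrightarrow> g u = 0"
  shows "differential f = g"
proof
  fix u
  show "differential f u = g u"
  proof (cases "u \<in> ball 0 1")
    case True
    show ?thesis
      unfolding differential_def frechet_derivative_at[OF f[OF True], symmetric]
      using True by (simp add: cdual_apply_inverse)
  qed (simp add: differential_def g del: mem_ball)
qed

lemma ex_primitive_in_HL0: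
  assumes g: "g \<in> Hinf_s"
  shows "\<exists>f \<in> HL0. differential f = g"
proof -
  define f where "f x = (if x \<in> ball 0 1 then radial_primitive g x else 0)" for x
  have df: "(f has_derivative cdual_apply (g x)) (at x)" if x: "x \<in> ball 0 1" for x
    using radial_primitive_has_derivative[OF g x] open_ball x
    by (rule has_derivative_transform_within_open) (simp add: f_def)
  have hol: "holomorphic_on_ball f"
    unfolding holomorphic_on_ball_def using df bounded_clinear_cdual_apply by blast
  have supp: "g u = 0" if "u \<notin> ball 0 1" for u
    using g that by (auto simp: Hinf_s_def Hinf_def supported_on_ball_def)
  have eq: "differential f = g"
    using df supp by (rule differential_eqI)
  have "bounded (g ` ball 0 1)" using g by (simp add: Hinf_s_def Hinf_def)
  then have le: "norm (differential f u) \<le> Hinf_norm g" if "u \<in> ball 0 1" for u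
    unfolding eq using that by (rule norm_le_Hinf_norm)
  have K: "0 \<le> Hinf_norm g" using order_trans[OF norm_ge_zero le[of 0]] by simp
  have lip: "norm (f x - f y) \<le> Hinf_norm g * norm (x - y)"
    if "x \<in> ball 0 1" "y \<in> ball 0 1" for x y
    using hol le that by (rule differential_bound_imp_lipschitz_bound)
  have f0: "f 0 = 0"
    using linear_0[OF bounded_linear.linear[OF bounded_linear_cdual_apply]]
    by (simp add: f_def radial_primitive_def)
  have "norm (f x) \<le> Hinf_norm g" if x: "x \<in> ball 0 1" for x
  proof -
    have "norm (f x) \<le> Hinf_norm g * norm x" using lip[OF x, of 0] f0 by simp
    also have "\<dots> \<le> Hinf_norm g" using x K by (intro mult_left_le) auto
    finally show ?thesis .
  qed
  then have "bounded (f ` ball 0 1)" by (intro boundedI) blast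
  moreover have "(Hinf_norm g)-lipschitz_on (ball 0 1) f"
    using lip K by (intro lipschitz_onI) (auto simp: dist_norm)
  moreover have "supported_on_ball f" by (simp add: supported_on_ball_def f_def)
  ultimately have "f \<in> HL0" using hol f0 by (auto simp: HL0_def Hinf_def)
  with eq show ?thesis by blast
qed

section \<open>The isometric isomorphism\<close>

lemma differential_in_Hinf_s:
  assumes f: "f \<in> HL0"
  shows "differential f \<in> Hinf_s"
proof -
  note second = differential_has_symmetric_derivative[OF HL0_holomorphic[OF f]]
  have "differential f \<in> Hinf"
    unfolding Hinf_def mem_Collect_eq
  proof (intro conjI)
    show "supported_on_ball (differential f)"
      by (simp add: supported_on_ball_def differential_def del: mem_ball)
    show "holomorphic_on_ball (differential f)"
      unfolding holomorphic_on_ball_def using second by blast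
    show "bounded (differential f ` ball 0 1)" by (rule bounded_differential[OF f])
  qed
  moreover have "frechet_derivative (\<lambda>v. cdual_apply (differential f v) x) (at u) y =
      frechet_derivative (\<lambda>v. cdual_apply (differential f v) y) (at u) x"
    if u: "u \<in> ball 0 1" for u x y
  proof -
    obtain G where G: "(differential f has_derivative G) (at u)"
      and sym: "\<And>k h. cdual_apply (G k) h = cdual_apply (G h) k"
      using second[OF u] by blast
    show ?thesis
      unfolding frechet_derivative_at[OF evaluation_has_derivative[OF G], symmetric] by (rule sym)
  qed
  ultimately show ?thesis by (simp add: Hinf_s_def)
qed

theorem theorem3p4:
  shows "isometric_isomorphism
    (HL0 :: ('a::complex_banach \<Rightarrow> complex) set) lip_norm
    (Hinf_s :: ('a \<Rightarrow> 'a cdual) set) Hinf_norm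
    differential"
  unfolding isometric_isomorphism_def
proof (intro conjI ballI allI)
  have off: "differential f u = 0" if "u \<notin> ball 0 1" for f :: "'a \<Rightarrow> complex" and u
    using that by (simp add: differential_def del: mem_ball)
  fix f :: "'a \<Rightarrow> complex" assume f: "f \<in> HL0"
  note df = has_derivative_differential[OF HL0_holomorphic[OF f]]
  show "Hinf_norm (differential f) = lip_norm f" by (rule Hinf_norm_differential[OF f])
  show "differential (\<lambda>x. c *\<^sub>C f x) = (\<lambda>u. c *\<^sub>C differential f u)" for c
    by (rule differential_eqI)
      (simp_all add: scaleC_cdual.rep_eq off scaleC_zero_right df
        bounded_linear.has_derivative[OF bounded_linear_scaleC_right] del: mem_ball)
  fix g :: "'a \<Rightarrow> complex" assume g: "g \<in> HL0"
  note dg = has_derivative_differential[OF HL0_holomorphic[OF g]]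
  show "differential (\<lambda>x. f x + g x) = (\<lambda>u. differential f u + differential g u)"
    by (rule differential_eqI)
      (simp_all add: plus_cdual.rep_eq off has_derivative_add df dg del: mem_ball)
next
  show "differential ` HL0 = (Hinf_s :: ('a \<Rightarrow> 'a cdual) set)"
    using differential_in_Hinf_s ex_primitive_in_HL0 by (auto simp: image_iff; metis)
qed

end
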